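(* Let $\Delta>0$, $0\le\epsilon\le\Delta$, $0\le\delta\le1$, let $D_{\mathcal X^n}$ be a distribution on $\mathcal X^n$, and let $A$ be an analyst that receives finite sequences of real responses and outputs queries in $\mathcal Q_\Delta$ (the $\Delta$-bounded linear queries). Let $\bar M=(M_1,\dots,M_k)$ be a sequence of $k$ mechanisms $M_i:\mathcal X^n\times\mathcal Q_\Delta\to\mathbb R$. If $\bar M$ is both $\left(\frac{\epsilon}{8\Delta},\frac{\epsilon^2\delta}{4800\Delta^2}\right)$-$k$-LSS and $\left(\frac\epsilon8,\frac{\epsilon\delta}{600\Delta}\right)$-$k$-Sample Accurate with respect to $D_{\mathcal X^n}$ and $A$, then $\bar M$ is $(\epsilon,\delta)$-$k$-Distribution Accurate with respect to $D_{\mathcal X^n}$ and $A$.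
   Context: $\mathcal X$ is a countable set and $n\in\mathbb N$. A mechanism $M:\mathcal X^n\times\mathcal Q\to\mathcal R$ is a possibly randomized function whose output distributions are discrete (response sets are treated as countable). For a distribution $D_{\mathcal X^n}$ and fixed $q$, write $D(r\mid s)=\Pr[M(s,q)=r]$, $D(s)=D_{\mathcal X^n}(s)$, $D(r)=\sum_sD(s)D(r\mid s)$, $D(s\mid r)=D(s)D(r\mid s)/D(r)$. For $s=(s_1,\dots,s_n)$, $D(x\mid s)=\frac1n|\{i:s_i=x\}|$; $D(x)=\sum_sD(s)D(x\mid s)$; $D(x\mid r)=\sum_sD(s\mid r)D(x\mid s)$. Only $r$ with $D(r)>0$ matter. Stability loss: $\ell(r)=\sum_{x:\,D(x\mid r)>D(x)}(D(x\mid r)-D(x))$. $M$ is $(\epsilon,\delta)$-LSS with respect to $D_{\mathcal X^n}$ and $q$ if for every set $\mathbf r$ of responses, $\sum_{r\in\mathbf r}D(r)(\ell(r)-\epsilon)\le\delta$. Linear queries: a $\Delta$-bounded linear query is given by a function $q:\mathcal X\to[-\Delta,\Delta]$, extended to samples by $q(s)=\frac1n\sum_{i=1}^nq(s_i)$; $\mathcal Q_\Delta$ is the set of these. $q(D_{\mathcal X^n}):=\mathbb E_{S\sim D_{\mathcal X^n}}[q(S)]$. Adaptivity: an analyst is a possibly randomized function $A$ from finite sequences of responses to queries. The adaptive mechanism $\mathrm{Adp}_{\bar M}$, on input $s\in\mathcal X^n$ and $A$: $v_0\leftarrow\emptyset$ (if $A$ is randomized, $v_0\leftarrow c$ where $c$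 are $A$'s coin tosses, drawn independently of $s$ from a discrete distribution; then $A$ is a deterministic function of the view); for $i=1,\dots,k$: $q_i\leftarrow A(v_{i-1})$, $r_i\leftarrow M_i(s,q_i)$ (fresh randomness), $v_i\leftarrow(v_{i-1},r_i)$; output the view $v_k$. $\bar M$ is $(\epsilon,\delta)$-$k$-LSS with respect to $D_{\mathcal X^n}$ and $A$ if $\mathrm{Adp}_{\bar M}$, seen as a mechanism with "query" $A$ and "response" $v_k$, is $(\epsilon,\delta)$-LSS with respect to $D_{\mathcal X^n}$ and $A$. Accuracy: draw $S\sim D_{\mathcal X^n}$ and run the adaptive mechanism $\mathrm{Adp}_{\bar M}$ on input $S$ and $A$, producing queries $q_1,\dots,q_k$ (with $q_i=A(v_{i-1})$) and responses $R_1,\dots,R_k$ (with $R_i\sim M_i(S,q_i)$). $\bar M$ is $(\epsilon,\delta)$-$k$-Sample Accurate with respect to $D_{\mathcal X^n}$ and $A$ if $\Pr[\max_{i\le k}|R_i-q_i(S)|>\epsilon]\le\delta$, and $(\epsilon,\delta)$-$k$-Distribution Accurate if $\Pr[\max_{i\le k}|R_i-q_i(D_{\mathcal X^n})|>\epsilon]\le\delta$; probabilities are over $S$, the mechanisms' randomness and the analyst's coins. *)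

theory Defs
  imports "HOL-Probability.Probability"
begin

text \<open>
  A sample in \<open>X\<^sup>n\<close> is a list of length \<open>n\<close> over a countable type; a distribution on \<open>X\<^sup>n\<close> is
  a pmf on lists whose support consists of lists of length \<open>n\<close>.
\<close>

definition sample_space :: "nat \<Rightarrow> 'x list set" where
  "sample_space n = {s. length s = n}"

type_synonym ('x, 'q, 'r) mechanism = "'x list \<Rightarrow> 'q \<Rightarrow> 'r pmf"


text \<open>
  In the names below, \<open>x\<close>, \<open>s\<close>, \<open>r\<close> stand for a domain element, a sample and a response:
  \<open>D_x_s x s\<close> is \<open>D(x | s)\<close>, and so on.
\<close>

definition D_x_s :: "'x \<Rightarrow> 'x list \<Rightarrow> real" where
  "D_x_s x s = real (card {i. i < length s \<and> s ! i = x}) / real (length s)"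

definition D_x :: "'x list pmf \<Rightarrow> 'x \<Rightarrow> real" where
  "D_x D x = (\<Sum>\<^sub>\<infinity>s. pmf D s * D_x_s x s)"

definition D_r :: "'x list pmf \<Rightarrow> ('x, 'q, 'r) mechanism \<Rightarrow> 'q \<Rightarrow> 'r \<Rightarrow> real" where
  "D_r D M q r = (\<Sum>\<^sub>\<infinity>s. pmf D s * pmf (M s q) r)"

text \<open>
  If \<open>D(r) = 0\<close>, the next quantity is \<open>0\<close> by the convention on division; such \<open>r\<close> enter
  \<open>LSS\<close> only with weight \<open>D(r) = 0\<close>.
\<close>

definition D_s_r :: "'x list pmf \<Rightarrow> ('x, 'q, 'r) mechanism \<Rightarrow> 'q \<Rightarrow> 'x list \<Rightarrow> 'r \<Rightarrow> real" where
  "D_s_r D M q s r = pmf D s * pmf (M s q) r / D_r D M q r"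

definition D_x_r :: "'x list pmf \<Rightarrow> ('x, 'q, 'r) mechanism \<Rightarrow> 'q \<Rightarrow> 'x \<Rightarrow> 'r \<Rightarrow> real" where
  "D_x_r D M q x r = (\<Sum>\<^sub>\<infinity>s. D_s_r D M q s r * D_x_s x s)"

definition stability_loss :: "'x list pmf \<Rightarrow> ('x, 'q, 'r) mechanism \<Rightarrow> 'q \<Rightarrow> 'r \<Rightarrow> real" where
  "stability_loss D M q r =
     (\<Sum>\<^sub>\<infinity>x\<in>{x. D_x_r D M q x r > D_x D x}. D_x_r D M q x r - D_x D x)"

definition LSS :: "real \<Rightarrow> real \<Rightarrow> 'x list pmf \<Rightarrow> 'q \<Rightarrow> ('x, 'q, 'r) mechanism \<Rightarrow> bool" where
  "LSS \<epsilon> \<delta> D q M \<longleftrightarrow>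
     (\<forall>R. (\<Sum>\<^sub>\<infinity>r\<in>R. D_r D M q r * (stability_loss D M q r - \<epsilon>)) \<le> \<delta>)"


text \<open>
  A linear query is identified with the function on the domain that gives it; its extension to
  samples is \<open>query_sample\<close>.
\<close>

definition linear_queries :: "real \<Rightarrow> ('x \<Rightarrow> real) set" where
  "linear_queries \<Delta> = {q. \<forall>x. q x \<in> {-\<Delta>..\<Delta>}}"

definition query_sample :: "('x \<Rightarrow> real) \<Rightarrow> 'x list \<Rightarrow> real" where
  "query_sample q s = (\<Sum>i<length s. q (s ! i)) / real (length s)"

definition query_dist :: "('x \<Rightarrow> real) \<Rightarrow> 'x list pmf \<Rightarrow> real" where
  "query_dist q D = measure_pmf.expectation D (query_sample q)"


text \<open>
  A view consists of the analyst's coin tosses and the responses received so far. An analyst is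
  the distribution of its coin tosses together with a deterministic function from views to
  queries. A deterministic analyst is the case where the coin type is \<open>unit\<close>.
\<close>

type_synonym ('c, 'r) view = "'c \<times> 'r list"

type_synonym ('c, 'r, 'q) analyst = "'c pmf \<times> (('c, 'r) view \<Rightarrow> 'q)"

text \<open>Mechanisms are indexed from \<open>0\<close>: the sequence of \<open>k\<close> mechanisms is \<open>M 0, \<dots>, M (k - 1)\<close>.\<close>

primrec Adp ::
  "(nat \<Rightarrow> ('x, 'q, 'r) mechanism) \<Rightarrow> nat \<Rightarrow> ('x, ('c, 'r, 'q) analyst, ('c, 'r) view) mechanism"
where
  "Adp M 0 s A = do { c \<leftarrow> fst A; return_pmf (c, []) }"
| "Adp M (Suc i) s A = do {
     v \<leftarrow> Adp M i s A;
     r \<leftarrow> M i s (snd A v);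
     return_pmf (fst v, snd v @ [r])
   }"

definition k_LSS ::
  "nat \<Rightarrow> real \<Rightarrow> real \<Rightarrow> 'x list pmf \<Rightarrow> ('c, 'r, 'q) analyst \<Rightarrow> (nat \<Rightarrow> ('x, 'q, 'r) mechanism) \<Rightarrow> bool"
where
  "k_LSS k \<epsilon> \<delta> D A M \<longleftrightarrow> LSS \<epsilon> \<delta> D A (Adp M k)"

definition sample_and_view ::
  "nat \<Rightarrow> 'x list pmf \<Rightarrow> ('c, 'r, 'q) analyst \<Rightarrow> (nat \<Rightarrow> ('x, 'q, 'r) mechanism)
    \<Rightarrow> ('x list \<times> ('c, 'r) view) pmf"
where
  "sample_and_view k D A M = do { s \<leftarrow> D; v \<leftarrow> Adp M k s A; return_pmf (s, v) }"

text \<open>The (zero-based) \<open>i\<close>-th query and response of a run can be read off from its final view.\<close>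

definition view_query :: "('c, 'r, 'q) analyst \<Rightarrow> ('c, 'r) view \<Rightarrow> nat \<Rightarrow> 'q" where
  "view_query A v i = snd A (fst v, take i (snd v))"

definition view_response :: "('c, 'r) view \<Rightarrow> nat \<Rightarrow> 'r" where
  "view_response v i = snd v ! i"

text \<open>
  The maximal error against the reference answers \<open>ans\<close>. Errors are nonnegative, so
  inserting \<open>0\<close> only fixes the value of the maximum for \<open>k = 0\<close>.
\<close>

definition max_error ::
  "nat \<Rightarrow> ('c, real, 'x \<Rightarrow> real) analyst \<Rightarrow> (('x \<Rightarrow> real) \<Rightarrow> real) \<Rightarrow> ('c, real) view \<Rightarrow> real"
where
  "max_error k A ans v =
     Max (insert 0 ((\<lambda>i. \<bar>view_response v i - ans (view_query A v i)\<bar>) ` {..<k}))"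

definition k_sample_accurate ::
  "nat \<Rightarrow> real \<Rightarrow> real \<Rightarrow> 'x list pmf \<Rightarrow> ('c, real, 'x \<Rightarrow> real) analyst
    \<Rightarrow> (nat \<Rightarrow> ('x, 'x \<Rightarrow> real, real) mechanism) \<Rightarrow> bool"
where
  "k_sample_accurate k \<epsilon> \<delta> D A M \<longleftrightarrow>
     measure_pmf.prob (sample_and_view k D A M)
       {(s, v). max_error k A (\<lambda>q. query_sample q s) v > \<epsilon>} \<le> \<delta>"

definition k_distribution_accurate ::
  "nat \<Rightarrow> real \<Rightarrow> real \<Rightarrow> 'x list pmf \<Rightarrow> ('c, real, 'x \<Rightarrow> real) analyst
    \<Rightarrow> (nat \<Rightarrow> ('x, 'x \<Rightarrow> real, real) mechanism) \<Rightarrow> bool"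
where
  "k_distribution_accurate k \<epsilon> \<delta> D A M \<longleftrightarrow>
     measure_pmf.prob (sample_and_view k D A M)
       {(s, v). max_error k A (\<lambda>q. query_dist q D) v > \<epsilon>} \<le> \<delta>"

end

(*
  Conditioning on a view v turns both the sample and a uniformly drawn element of it into posterior
  distributions. The stability loss l(v) is the total variation distance between the posterior and
  the prior of the element, so for every Delta-bounded query q the posterior mean of q(S) is within
  2 Delta l(v) of q(D). Let b(v) be the posterior probability that some answer in v is inaccurate on
  the sample. If b(v) < 1, every answer in v is within eps/8 + 2 Delta (l(v) + b(v)) of the true one,
  hence every view with distribution error above eps has 2 Delta (l(v) + b(v)) > 7 eps/8, also when
  b(v) = 1. Averaging over the set B of these views, LSS bounds the contribution of l - eps/(8 Delta)
  and sample accuracy that of b, which leaves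
    (5 eps/8) P(B) <= eps delta (1/2400 + 1/300).
  Since the views carry their own queries, no amplification over several runs is needed. For
  eps = 0 the strict pointwise inequality forces P(B) = 0.
*)

theory Submission
  imports Defs
begin

section \<open>Expectations of bounded functions under a pmf\<close>

lemma integrable_pmf_bounded:
  fixes f :: "'a \<Rightarrow> real"
  assumes "\<And>x. x \<in> set_pmf p \<Longrightarrow> \<bar>f x\<bar> \<le> B"
  shows "integrable (measure_pmf p) f"
  by (rule measure_pmf.integrable_const_bound[where B = B]) (auto intro!: AE_pmfI assms)

lemma expectation_pmf_mono:
  fixes f g :: "'a \<Rightarrow> real"
  assumes "integrable (measure_pmf p) f" "integrable (measure_pmf p) g"
    and "\<And>x. x \<in> set_pmf p \<Longrightarrow> f x \<le> g x"
  shows "measure_pmf.expectation p f \<le> measure_pmf.expectation p g"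
  by (rule integral_mono_AE) (use assms in \<open>auto intro: AE_pmfI\<close>)

lemma abs_expectation_pmf_le:
  fixes f :: "'a \<Rightarrow> real"
  assumes "\<And>x. x \<in> set_pmf p \<Longrightarrow> \<bar>f x\<bar> \<le> B"
  shows "\<bar>measure_pmf.expectation p f\<bar> \<le> B"
proof -
  have "integrable (measure_pmf p) f"
    using assms by (rule integrable_pmf_bounded)
  then have "measure_pmf.expectation p (\<lambda>x. \<bar>f x\<bar>) \<le> measure_pmf.expectation p (\<lambda>x. B)"
    by (intro expectation_pmf_mono) (use assms in auto)
  then show ?thesis
    using integral_abs_bound[of "measure_pmf p" f] by (simp del: integral_abs_bound)
qed

text \<open>Bridge between the two languages of the proof: stability is defined by infinite sums,
  while averaging is done with expectations. Integrability against a pmf is absolute summability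
  against its weights.\<close>

lemma has_sum_pmf_expectation:
  fixes f :: "'a \<Rightarrow> real"
  assumes "integrable (measure_pmf p) f"
  shows "((\<lambda>x. pmf p x * f x) has_sum measure_pmf.expectation p f) UNIV"
proof -
  have "integrable (count_space UNIV) (\<lambda>x. pmf p x * f x)"
    using assms unfolding measure_pmf_eq_density by (subst (asm) integrable_density) auto
  then have *: "Infinite_Set_Sum.abs_summable_on (\<lambda>x. pmf p x * f x) UNIV"
    by (simp add: Infinite_Set_Sum.abs_summable_on_def)
  then have "(\<lambda>x. pmf p x * f x) summable_on UNIV"
    by (rule summable_on_iff_abs_summable_on_real[THEN iffD2, OF abs_summable_equivalent[THEN iffD2]])
  moreover have "measure_pmf.expectation p f = infsum (\<lambda>x. pmf p x * f x) UNIV"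
    unfolding pmf_expectation_eq_infsetsum using * by (rule infsetsum_infsum)
  ultimately show ?thesis
    by (simp add: has_sum_infsum)
qed

lemma infsum_pmf_expectation:
  fixes f :: "'a \<Rightarrow> real"
  assumes "integrable (measure_pmf p) f"
  shows "(\<Sum>\<^sub>\<infinity>x. pmf p x * f x) = measure_pmf.expectation p f"
  using has_sum_pmf_expectation[OF assms] by (rule infsumI)

text \<open>For nonnegative functions this is the rule for \<open>nn_integral\<close>. Adding the
  bound \<open>B\<close> makes \<open>f\<close> nonnegative on the support; since both sides stay
  nonnegative after the shift, \<open>ennreal\<close> is injective there and \<open>B\<close>
  cancels.\<close>

lemma expectation_bind_pmf:
  fixes f :: "'b \<Rightarrow> real"
  assumes B: "\<And>y. y \<in> set_pmf (bind_pmf p h) \<Longrightarrow> \<bar>f y\<bar> \<le> B"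
  shows "measure_pmf.expectation (bind_pmf p h) f
    = measure_pmf.expectation p (\<lambda>x. measure_pmf.expectation (h x) f)"
proof -
  have Bx: "\<bar>f y\<bar> \<le> B" if "x \<in> set_pmf p" "y \<in> set_pmf (h x)" for x y
    using that by (intro B) auto
  have int: "integrable (h x) f" if "x \<in> set_pmf p" for x
    using Bx[OF that] by (rule integrable_pmf_bounded)
  have intb: "integrable (bind_pmf p h) f"
    using B by (rule integrable_pmf_bounded)
  have expb: "\<bar>measure_pmf.expectation (h x) f\<bar> \<le> B" if "x \<in> set_pmf p" for x
    using Bx[OF that] by (rule abs_expectation_pmf_le)
  then have inte: "integrable p (\<lambda>x. measure_pmf.expectation (h x) f)"
    by (rule integrable_pmf_bounded)
  have "ennreal (measure_pmf.expectation (bind_pmf p h) (\<lambda>y. f y + B))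
      = (\<integral>\<^sup>+x. \<integral>\<^sup>+y. ennreal (f y + B) \<partial>h x \<partial>p)"
    unfolding nn_integral_bind_pmf[symmetric] using intb B
    by (subst nn_integral_eq_integral) (force intro!: AE_pmfI)+
  also have "\<dots> = (\<integral>\<^sup>+x. ennreal (measure_pmf.expectation (h x) f + B) \<partial>p)"
  proof (intro nn_integral_cong_AE AE_pmfI)
    fix x assume x: "x \<in> set_pmf p"
    have "(\<integral>\<^sup>+y. ennreal (f y + B) \<partial>h x)
        = ennreal (measure_pmf.expectation (h x) (\<lambda>y. f y + B))"
      using int[OF x] Bx[OF x] by (intro nn_integral_eq_integral) (force intro!: AE_pmfI)+
    also have "\<dots> = ennreal (measure_pmf.expectation (h x) f + B)"
      using int[OF x] by simp
    finally show "(\<integral>\<^sup>+y. ennreal (f y + B) \<partial>h x)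
        = ennreal (measure_pmf.expectation (h x) f + B)" .
  qed
  also have "\<dots> = ennreal (measure_pmf.expectation p
      (\<lambda>x. measure_pmf.expectation (h x) f + B))"
    using inte expb by (intro nn_integral_eq_integral) (force intro!: AE_pmfI)+
  finally have "ennreal (measure_pmf.expectation (bind_pmf p h) f + B)
      = ennreal (measure_pmf.expectation p (\<lambda>x. measure_pmf.expectation (h x) f) + B)"
    using intb inte by simp
  moreover have "\<bar>measure_pmf.expectation (bind_pmf p h) f\<bar> \<le> B"
    using B by (rule abs_expectation_pmf_le)
  moreover have "\<bar>measure_pmf.expectation p (\<lambda>x. measure_pmf.expectation (h x) f)\<bar> \<le> B"
    using expb by (rule abs_expectation_pmf_le)
  ultimately show ?thesis
    by (subst (asm) ennreal_inj) auto
qed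

section \<open>Total variation distance, as the positive part of a difference of pmfs\<close>

definition pmf_excess :: "'a pmf \<Rightarrow> 'a pmf \<Rightarrow> real" where
  "pmf_excess p q = (\<Sum>\<^sub>\<infinity>x\<in>{x. pmf p x > pmf q x}. pmf p x - pmf q x)"

text \<open>Truncating at \<open>0\<close> moves the sum to \<open>UNIV\<close>, where it can be
  compared term by term with other sums.\<close>

lemma pmf_excess_has_sum:
  "((\<lambda>x. max 0 (pmf p x - pmf q x)) has_sum pmf_excess p q) UNIV"
proof -
  have p: "pmf p summable_on UNIV"
    using has_sum_pmf_expectation[of p "\<lambda>_. 1"] by (auto simp: summable_on_def)
  have "(\<lambda>x. max 0 (pmf p x - pmf q x)) summable_on UNIV"
    by (rule summable_on_comparison_test[OF p]) (auto simp: max_def)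
  then have "((\<lambda>x. max 0 (pmf p x - pmf q x)) has_sum
      (\<Sum>\<^sub>\<infinity>x. max 0 (pmf p x - pmf q x))) UNIV"
    by (rule has_sum_infsum)
  also have "(\<Sum>\<^sub>\<infinity>x. max 0 (pmf p x - pmf q x)) = pmf_excess p q"
    unfolding pmf_excess_def by (rule infsum_cong_neutral) (auto simp: max_def)
  finally show ?thesis .
qed

lemma pmf_excess_bounds: "0 \<le> pmf_excess p q" "pmf_excess p q \<le> 1"
proof -
  have p: "(pmf p has_sum 1) UNIV"
    using has_sum_pmf_expectation[of p "\<lambda>_. 1"] by simp
  show "0 \<le> pmf_excess p q"
    using pmf_excess_has_sum by (rule has_sum_nonneg) simp
  show "pmf_excess p q \<le> 1"
    using pmf_excess_has_sum p by (rule has_sum_mono) (auto simp: max_def)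
qed

lemma expectation_diff_le_pmf_excess:
  fixes f :: "'a \<Rightarrow> real"
  assumes f: "\<And>x. \<bar>f x\<bar> \<le> B"
  shows "measure_pmf.expectation p f - measure_pmf.expectation q f \<le> 2 * B * pmf_excess p q"
proof -
  have int: "integrable (measure_pmf r) f" for r
    using f by (rule integrable_pmf_bounded)
  \<comment> \<open>Shifting \<open>f\<close> into \<open>[0, 2B]\<close> does not change the difference of the expectations.\<close>
  have "((\<lambda>x. pmf r x * (f x + B)) has_sum (measure_pmf.expectation r f + B)) UNIV" for r
    using has_sum_pmf_expectation[of r "\<lambda>x. f x + B"] int[of r] by simp
  from has_sum_add[OF this[of p] has_sum_uminusI[OF this[of q]]]
  have "((\<lambda>x. (pmf p x - pmf q x) * (f x + B)) has_sum
      (measure_pmf.expectation p f - measure_pmf.expectation q f)) UNIV"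
    by (simp add: left_diff_distrib)
  moreover have "((\<lambda>x. 2 * B * max 0 (pmf p x - pmf q x)) has_sum 2 * B * pmf_excess p q) UNIV"
    by (intro has_sum_cmult_right pmf_excess_has_sum)
  ultimately show ?thesis
  proof (rule has_sum_mono)
    fix x
    have "0 \<le> f x + B" "f x + B \<le> 2 * B"
      using f[of x] by auto
    \<comment> \<open>The weight is nonnegative, so raising a negative difference to
      \<open>0\<close> only increases the term; a positive difference gets the largest possible
      weight.\<close>
    then have "(pmf p x - pmf q x) * (f x + B) \<le> max 0 (pmf p x - pmf q x) * (2 * B)"
      by (intro mult_mono) auto
    then show "(pmf p x - pmf q x) * (f x + B) \<le> 2 * B * max 0 (pmf p x - pmf q x)"
      by (simp add: mult.commute)
  qed
qed

lemma abs_expectation_diff_le_pmf_excess: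
  fixes f :: "'a \<Rightarrow> real"
  assumes "\<And>x. \<bar>f x\<bar> \<le> B"
  shows "\<bar>measure_pmf.expectation p f - measure_pmf.expectation q f\<bar> \<le> 2 * B * pmf_excess p q"
  using expectation_diff_le_pmf_excess[of f B p q]
    expectation_diff_le_pmf_excess[of "\<lambda>x. - f x" B p q] assms by (simp add: abs_le_iff)

section \<open>A uniformly drawn element of a sample\<close>

definition empirical :: "'x list \<Rightarrow> 'x pmf" where
  "empirical s = map_pmf ((!) s) (pmf_of_set {..<length s})"

text \<open>The empty sample is excluded because a uniform law on the empty index set carries no
  information, whereas \<open>D_x_s x []\<close> is \<open>0\<close> by division by zero.\<close>

lemma pmf_empirical:
  assumes "s \<noteq> []"
  shows "pmf (empirical s) x = D_x_s x s"
proof -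
  have "{..<length s} \<inter> (!) s -` {x} = {i. i < length s \<and> s ! i = x}"
    by auto
  moreover have "{..<length s} \<noteq> {}"
    using assms by auto
  ultimately show ?thesis
    by (simp add: empirical_def pmf_map measure_pmf_of_set D_x_s_def)
qed

lemma expectation_empirical:
  assumes "s \<noteq> []"
  shows "measure_pmf.expectation (empirical s) f = query_sample f s"
proof -
  have "{..<length s} \<noteq> {}"
    using assms by auto
  then show ?thesis
    by (simp add: empirical_def integral_pmf_of_set query_sample_def)
qed

text \<open>The right side has the shape of both \<open>D_x\<close> (with \<open>P\<close> the
  prior) and \<open>D_x_r\<close> (with \<open>P\<close> the posterior), so both become genuine pmfs
  of a drawn element.\<close>

lemma pmf_bind_empirical:
  assumes "[] \<notin> set_pmf P"
  shows "pmf (P \<bind> empirical) x = (\<Sum>\<^sub>\<infinity>s. pmf P s * D_x_s x s)"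
proof -
  have "pmf (P \<bind> empirical) x = (\<Sum>\<^sub>\<infinity>s. pmf P s * pmf (empirical s) x)"
    unfolding pmf_bind
    by (rule infsum_pmf_expectation[symmetric], rule integrable_pmf_bounded[of _ _ 1])
      (simp add: pmf_le_1)
  \<comment> \<open>The two terms may differ at \<open>[]\<close>, but there the factor
    \<open>pmf P s\<close> vanishes.\<close>
  also have "\<dots> = (\<Sum>\<^sub>\<infinity>s. pmf P s * D_x_s x s)"
    using assms pmf_empirical[of _ x] by (intro infsum_cong) (metis mult_eq_0_iff set_pmf_iff)
  finally show ?thesis .
qed

text \<open>Reduces the mean of a linear query on samples to the mean of a function of one element,
  to which the total variation bound applies.\<close>

lemma expectation_bind_empirical:
  assumes "[] \<notin> set_pmf P" "\<And>x. \<bar>f x\<bar> \<le> B"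
  shows "measure_pmf.expectation (P \<bind> empirical) f = measure_pmf.expectation P (query_sample f)"
proof -
  have "measure_pmf.expectation (P \<bind> empirical) f
      = measure_pmf.expectation P (\<lambda>s. measure_pmf.expectation (empirical s) f)"
    using assms(2) by (rule expectation_bind_pmf)
  also have "\<dots> = measure_pmf.expectation P (query_sample f)"
    using assms(1) expectation_empirical
    by (intro integral_cong_AE AE_pmfI) (auto intro!: expectation_empirical)
  finally show ?thesis .
qed

lemma abs_query_sample_le:
  assumes "s \<noteq> []" "\<And>x. \<bar>f x\<bar> \<le> B"
  shows "\<bar>query_sample f s\<bar> \<le> B"
  unfolding expectation_empirical[OF assms(1), symmetric]
  using assms(2) by (rule abs_expectation_pmf_le)

section \<open>Joint law of sample and response, its marginal and its posteriors\<close>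

definition joint_pmf :: "'x list pmf \<Rightarrow> ('x, 'q, 'r) mechanism \<Rightarrow> 'q \<Rightarrow> ('x list \<times> 'r) pmf" where
  "joint_pmf D M q = D \<bind> (\<lambda>s. map_pmf (Pair s) (M s q))"

definition response_pmf :: "'x list pmf \<Rightarrow> ('x, 'q, 'r) mechanism \<Rightarrow> 'q \<Rightarrow> 'r pmf" where
  "response_pmf D M q = D \<bind> (\<lambda>s. M s q)"

text \<open>Conditioning the joint law yields a pmf directly, with no normalisation to prove. It is
  meaningful only for responses of positive probability, hence the support hypothesis on
  \<open>r\<close> below.\<close>

definition posterior_pmf :: "'x list pmf \<Rightarrow> ('x, 'q, 'r) mechanism \<Rightarrow> 'q \<Rightarrow> 'r \<Rightarrow> 'x list pmf" where
  "posterior_pmf D M q r = map_pmf fst (cond_pmf (joint_pmf D M q) {(s, r'). r' = r})"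

lemma map_snd_joint_pmf: "map_pmf snd (joint_pmf D M q) = response_pmf D M q"
  by (simp add: joint_pmf_def response_pmf_def map_bind_pmf pmf.map_comp o_def)

lemma pmf_joint_pmf: "pmf (joint_pmf D M q) (s, r) = pmf D s * pmf (M s q) r"
proof -
  have "pmf (map_pmf (Pair s') (M s' q)) (s, r) = pmf (M s q) r * indicator {s} s'" for s'
  proof (cases "s' = s")
    case True
    then show ?thesis
      by (simp add: pmf_map_inj' inj_on_def)
  next
    case False
    then show ?thesis
      by (auto simp: pmf_eq_0_set_pmf)
  qed
  then have "pmf (joint_pmf D M q) (s, r)
      = measure_pmf.expectation D (\<lambda>s'. pmf (M s q) r * indicator {s} s')"
    by (simp only: joint_pmf_def pmf_bind)
  then show ?thesis
    by (simp add: measure_pmf_single)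
qed

lemma pmf_response_pmf: "pmf (response_pmf D M q) r = D_r D M q r"
  unfolding response_pmf_def pmf_bind D_r_def
  by (rule infsum_pmf_expectation[symmetric], rule integrable_pmf_bounded[of _ _ 1])
    (simp add: pmf_le_1)

lemma measure_joint_pmf_response:
  "measure_pmf.prob (joint_pmf D M q) {(s, r'). r' = r} = pmf (response_pmf D M q) r"
proof -
  have "{(s :: 'a list, r'). r' = r} = snd -` {r}"
    by auto
  then show ?thesis
    by (simp add: map_snd_joint_pmf[symmetric] pmf_map)
qed

context
  fixes D :: "'x list pmf" and M :: "('x, 'q, 'r) mechanism" and q :: 'q and r :: 'r
  assumes r: "r \<in> set_pmf (response_pmf D M q)"
begin

lemma joint_pmf_response_nonempty: "set_pmf (joint_pmf D M q) \<inter> {(s, r'). r' = r} \<noteq> {}"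
  using r by (auto simp: map_snd_joint_pmf[symmetric])

text \<open>Conditioning has fixed the second component, so projecting it away loses
  nothing.\<close>

lemma map_pair_posterior_pmf:
  "map_pmf (\<lambda>s. (s, r)) (posterior_pmf D M q r) = cond_pmf (joint_pmf D M q) {(s, r'). r' = r}"
  unfolding posterior_pmf_def pmf.map_comp
  by (rule map_pmf_idI) (auto simp: joint_pmf_response_nonempty)

lemma pmf_posterior_pmf: "pmf (posterior_pmf D M q r) s = D_s_r D M q s r"
proof -
  have "pmf (posterior_pmf D M q r) s = pmf (map_pmf (\<lambda>s. (s, r)) (posterior_pmf D M q r)) (s, r)"
    using pmf_map_inj'[of "\<lambda>s. (s, r)" "posterior_pmf D M q r" s] by (simp add: inj_on_def)
  then show ?thesis
    by (simp add: map_pair_posterior_pmf pmf_cond[OF joint_pmf_response_nonempty]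
        measure_joint_pmf_response pmf_joint_pmf D_s_r_def pmf_response_pmf)
qed

lemma set_posterior_pmf: "set_pmf (posterior_pmf D M q r) \<subseteq> set_pmf D"
  unfolding set_pmf_eq by (auto simp: pmf_posterior_pmf D_s_r_def)

lemma stability_loss_eq_pmf_excess:
  assumes "[] \<notin> set_pmf D"
  shows "stability_loss D M q r
    = pmf_excess (posterior_pmf D M q r \<bind> empirical) (D \<bind> empirical)"
proof -
  have "[] \<notin> set_pmf (posterior_pmf D M q r)"
    using assms set_posterior_pmf by auto
  then have "D_x_r D M q x r = pmf (posterior_pmf D M q r \<bind> empirical) x" for x
    by (simp add: D_x_r_def pmf_bind_empirical pmf_posterior_pmf)
  moreover have "D_x D x = pmf (D \<bind> empirical) x" for x
    using assms by (simp add: D_x_def pmf_bind_empirical)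
  ultimately show ?thesis
    by (simp add: stability_loss_def pmf_excess_def)
qed

lemma posterior_query_diff_le:
  assumes "[] \<notin> set_pmf D" "f \<in> linear_queries B"
  shows "\<bar>measure_pmf.expectation (posterior_pmf D M q r) (query_sample f) - query_dist f D\<bar>
    \<le> 2 * B * stability_loss D M q r"
proof -
  have f: "\<bar>f x\<bar> \<le> B" for x
    using assms(2) by (auto simp: linear_queries_def abs_le_iff minus_le_iff)
  have "[] \<notin> set_pmf (posterior_pmf D M q r)"
    using assms set_posterior_pmf by auto
  then have "measure_pmf.expectation (posterior_pmf D M q r) (query_sample f)
      = measure_pmf.expectation (posterior_pmf D M q r \<bind> empirical) f"
    using f by (rule expectation_bind_empirical[symmetric])
  moreover have "query_dist f D = measure_pmf.expectation (D \<bind> empirical) f"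
    unfolding query_dist_def using assms(1) f by (rule expectation_bind_empirical[symmetric])
  ultimately show ?thesis
    using abs_expectation_diff_le_pmf_excess[of f B] f
    by (simp add: stability_loss_eq_pmf_excess[OF assms(1)])
qed

end

text \<open>Disintegration: the response may be drawn first and the sample afterwards from its
  posterior. The averaged conditionals recombine because each fibre of \<open>snd\<close> has the
  mass that the marginal gives to its response.\<close>

lemma joint_pmf_eq_bind_response:
  fixes D :: "'x list pmf" and M :: "('x, 'q, 'r) mechanism"
  shows "joint_pmf D M q
    = response_pmf D M q \<bind> (\<lambda>r. map_pmf (\<lambda>s. (s, r)) (posterior_pmf D M q r))"
proof -
  let ?J = "joint_pmf D M q" and ?V = "response_pmf D M q"
  have "?V \<bind> (\<lambda>r. map_pmf (\<lambda>s. (s, r)) (posterior_pmf D M q r))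
      = ?V \<bind> (\<lambda>r. cond_pmf ?J {sr. r = snd sr})"
    by (intro bind_pmf_cong refl)
      (auto simp: map_pair_posterior_pmf intro!: arg_cong[where f = "cond_pmf ?J"])
  also have "\<dots> = ?J"
  proof (rule bind_cond_pmf_cancel)
    fix sr assume "sr \<in> set_pmf ?J"
    then show "set_pmf ?V \<inter> {r. r = snd sr} \<noteq> {}"
      by (auto simp: map_snd_joint_pmf[symmetric])
  next
    fix r assume "r \<in> set_pmf ?V"
    then show "set_pmf ?J \<inter> {sr. r = snd sr} \<noteq> {}"
      by (auto simp: map_snd_joint_pmf[symmetric])
  next
    fix r and sr :: "'x list \<times> 'r" assume "r = snd sr"
    moreover have "{sr' :: 'x list \<times> 'r. snd sr = snd sr'} = snd -` {snd sr}"
      by auto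
    moreover have "{r'. r' = snd sr} = {snd sr}"
      by auto
    ultimately show "measure ?J {sr. r = snd sr} = measure ?V {r. r = snd sr}"
      by (simp add: map_snd_joint_pmf[symmetric])
  qed
  finally show ?thesis ..
qed

lemma prob_joint_pmf:
  "measure_pmf.prob (joint_pmf D M q) E = measure_pmf.expectation (response_pmf D M q)
     (\<lambda>r. measure_pmf.prob (posterior_pmf D M q r) {s. (s, r) \<in> E})"
proof -
  have "measure_pmf.prob (joint_pmf D M q) E
      = measure_pmf.expectation (joint_pmf D M q) (indicator E)"
    by simp
  also have "\<dots> = measure_pmf.expectation (response_pmf D M q)
      (\<lambda>r. measure_pmf.expectation (map_pmf (\<lambda>s. (s, r)) (posterior_pmf D M q r)) (indicator E))"
    by (subst joint_pmf_eq_bind_response, rule expectation_bind_pmf[of _ _ _ 1])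
      (simp add: indicator_def)
  also have "\<dots> = measure_pmf.expectation (response_pmf D M q)
      (\<lambda>r. measure_pmf.prob (posterior_pmf D M q r) {s. (s, r) \<in> E})"
    by (simp del: integral_map_pmf add: vimage_def)
  finally show ?thesis .
qed

section \<open>What stability and sample accuracy give for responses\<close>

lemma stability_loss_bounds:
  assumes "[] \<notin> set_pmf D" "r \<in> set_pmf (response_pmf D M q)"
  shows "0 \<le> stability_loss D M q r" "stability_loss D M q r \<le> 1"
  using assms by (simp_all add: stability_loss_eq_pmf_excess pmf_excess_bounds)

text \<open>The indicator form lets the stability bound be combined linearly with other
  expectations. The loss lies in [0,1], which supplies integrability.\<close>

lemma LSS_expectation_le:
  assumes "LSS e d D q M" "[] \<notin> set_pmf D"
  shows "measure_pmf.expectation (response_pmf D M q)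
    (\<lambda>r. indicator R r * (stability_loss D M q r - e)) \<le> d"
proof -
  let ?f = "\<lambda>r. indicator R r * (stability_loss D M q r - e)"
  have "\<bar>?f r\<bar> \<le> 1 + \<bar>e\<bar>" if "r \<in> set_pmf (response_pmf D M q)" for r
    using stability_loss_bounds[OF assms(2) that] by (auto simp: indicator_def)
  then have "measure_pmf.expectation (response_pmf D M q) ?f
      = (\<Sum>\<^sub>\<infinity>r. D_r D M q r * ?f r)"
    unfolding pmf_response_pmf[symmetric]
    by (intro infsum_pmf_expectation[symmetric] integrable_pmf_bounded)
  also have "\<dots> = (\<Sum>\<^sub>\<infinity>r\<in>R. D_r D M q r * (stability_loss D M q r - e))"
    by (rule infsum_cong_neutral) (auto simp: indicator_def)
  also have "\<dots> \<le> d"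
    using assms(1) by (simp add: LSS_def)
  finally show ?thesis .
qed

text \<open>The posterior mean of the sample error is at most \<open>\<eta>\<close> plus
  \<open>2 * B\<close> times the mass of the bad samples; the stability loss pays for passing from
  the posterior mean to the true mean.\<close>

lemma distribution_error_le:
  fixes a \<eta> B :: real
  assumes r: "r \<in> set_pmf (response_pmf D M q)" and D: "[] \<notin> set_pmf D"
    and f: "f \<in> linear_queries B"
    and nz: "measure_pmf.prob (posterior_pmf D M q r) {s. \<bar>a - query_sample f s\<bar> > \<eta>} \<noteq> 1"
  shows "\<bar>a - query_dist f D\<bar> \<le> \<eta> + 2 * B * (stability_loss D M q r
    + measure_pmf.prob (posterior_pmf D M q r) {s. \<bar>a - query_sample f s\<bar> > \<eta>})"
proof -
  let ?P = "posterior_pmf D M q r"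
  define bad where "bad = {s. \<bar>a - query_sample f s\<bar> > \<eta>}"
  have "\<bar>f x\<bar> \<le> B" for x
    using f by (auto simp: linear_queries_def abs_le_iff minus_le_iff)
  then have qB: "\<bar>query_sample f s\<bar> \<le> B" if "s \<in> set_pmf ?P" for s
    using that set_posterior_pmf[OF r] D by (intro abs_query_sample_le) auto
  \<comment> \<open>The answer \<open>a\<close> has no a priori bound. One good sample in the
    support puts it within \<open>\<eta>\<close> of [-B,B], which caps the error on bad samples at
    \<open>\<eta> + 2 * B\<close>.\<close>
  obtain s0 where s0: "s0 \<in> set_pmf ?P" "\<bar>a - query_sample f s0\<bar> \<le> \<eta>"
    using nz by (auto simp: measure_pmf.prob_eq_1 AE_measure_pmf_iff not_less)
  have dist: "\<bar>a - query_sample f s\<bar> \<le> \<eta> + 2 * B * indicator bad s" if "s \<in> set_pmf ?P" for s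
  proof (cases "s \<in> bad")
    case True
    moreover have "\<bar>a - query_sample f s\<bar> \<le> \<eta> + 2 * B"
      using qB[OF that] qB[OF s0(1)] s0(2) by linarith
    ultimately show ?thesis
      by simp
  qed (auto simp: bad_def)
  have int: "integrable ?P (query_sample f)"
    using qB by (rule integrable_pmf_bounded)
  have ind: "integrable ?P (indicator bad :: _ \<Rightarrow> real)"
    by (rule integrable_pmf_bounded[of _ _ 1]) (auto simp: indicator_def)
  then have intb: "integrable ?P (\<lambda>s. \<eta> + 2 * B * indicator bad s)"
    by simp
  have "\<bar>a - measure_pmf.expectation ?P (query_sample f)\<bar>
      = \<bar>measure_pmf.expectation ?P (\<lambda>s. a - query_sample f s)\<bar>"
    using int by simp
  also have "\<dots> \<le> measure_pmf.expectation ?P (\<lambda>s. \<bar>a - query_sample f s\<bar>)"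
    by (rule integral_abs_bound)
  also have "\<dots> \<le> measure_pmf.expectation ?P (\<lambda>s. \<eta> + 2 * B * indicator bad s)"
    using int intb dist by (intro expectation_pmf_mono) auto
  also have "\<dots> = \<eta> + 2 * B * measure_pmf.prob ?P bad"
    using ind by simp
  finally show ?thesis
    using posterior_query_diff_le[OF r D f] by (simp add: bad_def algebra_simps)
qed

section \<open>Adaptive runs and their maximal error\<close>

lemma set_Adp_fst: "v \<in> set_pmf (Adp M k s A) \<Longrightarrow> fst v \<in> set_pmf (fst A)"
  by (induction k arbitrary: v) auto

text \<open>A nonnegative threshold is never exceeded by the inserted \<open>0\<close>, so only
  actual answers can witness the excess.\<close>

lemma max_error_greater_iff:
  assumes "0 \<le> \<eta>"
  shows "max_error k A ans v > \<eta>
    \<longleftrightarrow> (\<exists>i<k. \<bar>view_response v i - ans (view_query A v i)\<bar> > \<eta>)"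
  using assms by (auto simp: max_error_def Max_gr_iff)

theorem theorem3p9:
  fixes \<Delta> \<epsilon> \<delta> :: real
    and n k :: nat
    and D :: "'x::countable list pmf"
    and A :: "('c, real, 'x \<Rightarrow> real) analyst"
    and M :: "nat \<Rightarrow> ('x, 'x \<Rightarrow> real, real) mechanism"
  assumes "\<Delta> > 0" and "0 \<le> \<epsilon>" and "\<epsilon> \<le> \<Delta>" and "0 \<le> \<delta>" and "\<delta> \<le> 1"
    and "n \<ge> 1"
    and "set_pmf D \<subseteq> sample_space n"
    and "\<And>c rs. c \<in> set_pmf (fst A) \<Longrightarrow> snd A (c, rs) \<in> linear_queries \<Delta>"
    and "k_LSS k (\<epsilon> / (8 * \<Delta>)) (\<epsilon>\<^sup>2 * \<delta> / (4800 * \<Delta>\<^sup>2)) D A M"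
    and "k_sample_accurate k (\<epsilon> / 8) (\<epsilon> * \<delta> / (600 * \<Delta>)) D A M"
  shows "k_distribution_accurate k \<epsilon> \<delta> D A M"
proof -
  let ?J = "joint_pmf D (Adp M k) A" and ?V = "response_pmf D (Adp M k) A"
    and ?P = "posterior_pmf D (Adp M k) A" and ?l = "stability_loss D (Adp M k) A"
  define E where "E = {(s, v). max_error k A (\<lambda>q. query_sample q s) v > \<epsilon> / 8}"
  define B where "B = {v. max_error k A (\<lambda>q. query_dist q D) v > \<epsilon>}"
  define b where "b v = measure_pmf.prob (?P v) {s. (s, v) \<in> E}" for v
  have D: "[] \<notin> set_pmf D"
    using assms(6,7) by (auto simp: sample_space_def)
  have J: "sample_and_view k D A M = ?J"
    by (simp add: sample_and_view_def joint_pmf_def map_pmf_def)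

  have loss_plus_bad: "7 * \<epsilon> / 8 < 2 * \<Delta> * (?l v + b v)" if v: "v \<in> set_pmf ?V" "v \<in> B" for v
  proof -
    obtain i where i: "i < k" "\<bar>view_response v i - query_dist (view_query A v i) D\<bar> > \<epsilon>"
      using v(2) assms(2) by (auto simp: B_def max_error_greater_iff)
    let ?f = "view_query A v i"
    let ?bad = "{s. \<bar>view_response v i - query_sample ?f s\<bar> > \<epsilon> / 8}"
    \<comment> \<open>Boundedness of the queries is assumed only for coins in the support; a view
      retains its coins throughout the run.\<close>
    have "fst v \<in> set_pmf (fst A)"
      using v(1) by (auto simp: response_pmf_def dest: set_Adp_fst)
    then have f: "?f \<in> linear_queries \<Delta>"
      by (simp add: view_query_def assms(8))
    have "0 \<le> \<epsilon> / 8"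
      using assms(2) by simp
    then have "?bad \<subseteq> {s. (s, v) \<in> E}"
      using i(1) unfolding E_def max_error_greater_iff[OF \<open>0 \<le> \<epsilon> / 8\<close>] by blast
    then have bad_le: "measure_pmf.prob (?P v) ?bad \<le> b v"
      unfolding b_def by (intro measure_pmf.finite_measure_mono) auto
    show ?thesis
    proof (cases "measure_pmf.prob (?P v) ?bad = 1")
      case True
      \<comment> \<open>Here \<open>b v\<close> is at least 1, so the right side is at least
        \<open>2 * \<Delta>\<close>, which exceeds \<open>7 * \<epsilon> / 8\<close> because
        \<epsilon> \<le> \<Delta> and \<Delta> is positive.\<close>
      then have "2 * \<Delta> * 1 \<le> 2 * \<Delta> * (?l v + b v)"
        using bad_le stability_loss_bounds(1)[OF D v(1)] assms(1) by (intro mult_left_mono) auto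
      then show ?thesis
        using assms(1-3) by linarith
    next
      case False
      have "2 * \<Delta> * (?l v + measure_pmf.prob (?P v) ?bad) \<le> 2 * \<Delta> * (?l v + b v)"
        using bad_le assms(1) by (intro mult_left_mono) auto
      then show ?thesis
        using distribution_error_le[OF v(1) D f False] i(2) by linarith
    qed
  qed

  \<comment> \<open>On \<open>B\<close> this is the slack in \<open>loss_plus_bad\<close>, with 7/8
    split as 1/4 + 5/8: the quarter is \<open>2 * \<Delta>\<close> times the stability threshold,
    and the rest will bound the probability of \<open>B\<close>.\<close>
  define g where "g v = 2 * \<Delta> * (indicator B v * (?l v - \<epsilon> / (8 * \<Delta>)))
    + 2 * \<Delta> * (indicator B v * b v) - 5 * \<epsilon> / 8 * indicator B v" for v
  have g_pos: "g v > 0" if "v \<in> set_pmf ?V" "v \<in> B" for v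
  proof -
    have "g v = 2 * \<Delta> * (?l v + b v) - 7 * \<epsilon> / 8"
      using that(2) assms(1) by (simp add: g_def field_simps)
    then show ?thesis
      using loss_plus_bad[OF that] by simp
  qed
  have g_zero: "g v = 0" if "v \<notin> B" for v
    using that by (simp add: g_def)
  have g_nonneg: "AE v in ?V. 0 \<le> g v"
    using g_pos g_zero by (intro AE_pmfI) (metis less_imp_le order_refl)
  have int_loss: "integrable ?V (\<lambda>v. indicator B v * (?l v - \<epsilon> / (8 * \<Delta>)))"
  proof (rule integrable_pmf_bounded)
    fix v assume "v \<in> set_pmf ?V"
    then show "\<bar>indicator B v * (?l v - \<epsilon> / (8 * \<Delta>))\<bar> \<le> 1 + \<bar>\<epsilon> / (8 * \<Delta>)\<bar>"
      using stability_loss_bounds[OF D, of v "Adp M k" A]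
      by (auto simp: indicator_def simp del: abs_divide)
  qed
  have b_bounds: "0 \<le> b v" "b v \<le> 1" for v
    by (simp_all add: b_def)
  have int_bad: "integrable ?V (\<lambda>v. indicator B v * b v)"
    using b_bounds by (intro integrable_pmf_bounded[of _ _ 1]) (auto simp: indicator_def)
  have int_B: "integrable ?V (indicator B :: _ \<Rightarrow> real)"
    by (rule integrable_pmf_bounded[of _ _ 1]) (auto simp: indicator_def)
  have int_g: "integrable ?V g"
    unfolding g_def using int_loss int_bad int_B by simp
  have g_eq: "measure_pmf.expectation ?V g
      = 2 * \<Delta> * measure_pmf.expectation ?V (\<lambda>v. indicator B v * (?l v - \<epsilon> / (8 * \<Delta>)))
        + 2 * \<Delta> * measure_pmf.expectation ?V (\<lambda>v. indicator B v * b v)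
        - 5 * \<epsilon> / 8 * measure_pmf.prob ?V B"
    unfolding g_def using int_loss int_bad int_B by simp
  have loss_le: "measure_pmf.expectation ?V (\<lambda>v. indicator B v * (?l v - \<epsilon> / (8 * \<Delta>)))
      \<le> \<epsilon>\<^sup>2 * \<delta> / (4800 * \<Delta>\<^sup>2)"
    using assms(9) D unfolding k_LSS_def by (rule LSS_expectation_le)
  \<comment> \<open>Dropping the restriction to \<open>B\<close> is harmless since \<open>b\<close>
    is nonnegative; its full average is the probability of a sample error.\<close>
  have "measure_pmf.expectation ?V (\<lambda>v. indicator B v * b v) \<le> measure_pmf.expectation ?V b"
    using b_bounds int_bad
    by (intro expectation_pmf_mono integrable_pmf_bounded[of _ b 1]) (auto simp: indicator_def)
  also have "\<dots> = measure_pmf.prob ?J E"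
    by (simp add: prob_joint_pmf b_def[abs_def])
  also have "\<dots> \<le> \<epsilon> * \<delta> / (600 * \<Delta>)"
    using assms(10) by (simp add: k_sample_accurate_def J E_def)
  finally have bad_le: "measure_pmf.expectation ?V (\<lambda>v. indicator B v * b v)
      \<le> \<epsilon> * \<delta> / (600 * \<Delta>)" .
  have "measure_pmf.prob ?V B \<le> \<delta>"
  proof (cases "\<epsilon> = 0")
    case True
    \<comment> \<open>Both error budgets vanish, so the nonnegative \<open>g\<close> has mean
      \<open>0\<close> and is zero almost everywhere. Being strictly positive on the support within
      \<open>B\<close>, it leaves \<open>B\<close> no mass.\<close>
    have "measure_pmf.expectation ?V g \<le> 2 * \<Delta> * 0 + 2 * \<Delta> * 0 - 0"
      unfolding g_eq using True loss_le bad_le assms(1)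
      by (intro diff_mono add_mono mult_left_mono) auto
    moreover have "0 \<le> measure_pmf.expectation ?V g"
      using g_nonneg by (rule integral_nonneg_AE)
    ultimately have "AE v in ?V. g v = 0"
      using integral_nonneg_eq_0_iff_AE[OF int_g g_nonneg] by simp
    then have "AE v in ?V. v \<notin> B"
      using g_pos by (force simp: AE_measure_pmf_iff)
    then have "measure_pmf.prob ?V B = 0"
      by (subst measure_pmf.prob_eq_0) auto
    then show ?thesis
      using assms(4) by simp
  next
    case False
    define c where "c = \<epsilon> / \<Delta> * \<delta>"
    have "0 \<le> measure_pmf.expectation ?V g"
      using g_nonneg by (rule integral_nonneg_AE)
    also have "\<dots> \<le> 2 * \<Delta> * (\<epsilon>\<^sup>2 * \<delta> / (4800 * \<Delta>\<^sup>2)) + 2 * \<Delta> * (\<epsilon> * \<delta> / (600 * \<Delta>))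
        - 5 * \<epsilon> / 8 * measure_pmf.prob ?V B"
      unfolding g_eq using loss_le bad_le assms(1,2)
      by (intro diff_mono add_mono mult_left_mono) auto
    also have "2 * \<Delta> * (\<epsilon>\<^sup>2 * \<delta> / (4800 * \<Delta>\<^sup>2)) = \<epsilon> * (c / 2400)"
      using assms(1) by (simp add: c_def power2_eq_square mult_ac)
    also have "2 * \<Delta> * (\<epsilon> * \<delta> / (600 * \<Delta>)) = \<epsilon> * (\<delta> / 300)"
      using assms(1) by simp
    also have "\<epsilon> * (c / 2400) + \<epsilon> * (\<delta> / 300) - 5 * \<epsilon> / 8 * measure_pmf.prob ?V B
        = \<epsilon> * (c / 2400 + \<delta> / 300 - 5 / 8 * measure_pmf.prob ?V B)"
      by (simp add: algebra_simps)
    finally have "0 \<le> c / 2400 + \<delta> / 300 - 5 / 8 * measure_pmf.prob ?V B"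
      using False assms(2) by (simp add: zero_le_mult_iff)
    \<comment> \<open>By \<epsilon> \<le> \<Delta>. The probability of \<open>B\<close> is then at
      most 8/5 * (1/2400 + 1/300) = 3/500 times \<delta>.\<close>
    moreover have "c \<le> 1 * \<delta>"
      unfolding c_def using assms(1-4) by (intro mult_right_mono) auto
    ultimately show ?thesis
      using assms(4) by linarith
  qed
  \<comment> \<open>The distribution error depends on the view alone, so its probability in the
    joint law is that of \<open>B\<close> in the marginal.\<close>
  moreover have "{(s :: 'x list, v). max_error k A (\<lambda>q. query_dist q D) v > \<epsilon>} = snd -` B"
    by (auto simp: B_def)
  ultimately show ?thesis
    by (simp add: k_distribution_accurate_def J map_snd_joint_pmf[symmetric])
qed

end
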